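(* Consider the sandpile dynamics in which each cell is allowed to topple at most once. Then both of the following hold. (a) There exist two neighborhoods $A,B$ such that some non-uniform $\{A,B\}$-grid admits a crossing gate, but for all integers $p,q\ge 1$, no uniform grid with neighborhood $A^pB^q$ admits a crossing gate. (b) There exist two neighborhoods $A,B$ such that some uniform grid with neighborhood $A^1B^1$ admits a crossing gate, but no non-uniform $\{A,B\}$-grid admits a crossing gate.
   Context: Grids. For $\ell,\ell'\ge 1$ let $V=\{1,\dots,\ell\}\times\{1,\dots,\ell'\}$ be the set of cells; the first coordinate increases to the East and the second coordinate increases to the North. The West, East, South and North edges of the grid are the sets of cells with first coordinate $1$, first coordinate $\ell$, second coordinate $1$, second coordinate $\ell'$, respectively; corners are cells lying on two edges of different axes. A neighborhood is a nonempty finite multiset $N$ of elements of $\mathbb{Z}^2\setminus\{(0,0)\}$; $N(\delta)$ denotes the multiplicity of $\delta$ and $|N|$ the total number of elements counted with multiplicity. For neighborhoods $A,B$ and $p,q\ge 1$, $A^pB^q$ denotes the neighborhood with multiplicities $\delta\mapsto pA(\delta)+qB(\delta)$. A grid is a set of cells $V=\{1,\dots,\ell\}\times\{1,\dots,\ell'\}$ for some $\ell,\ell'\ge 1$, together with a neighborhood $N_u$ for each cell $u\in V$. It is uniform with neighborhood $N$ if $N_u=N$ for all $u$. A non-uniform $\{A,B\}$-grid is a grid in which $N_u\in\{A,B\}$ for every $u\in V$, the choice being allowed to depend on $u$. In the claim, grids of all sizes $\ell,\ell'$ are considered. Dynamics (each cell topples at most once). A configuration is a function $c:V\to\mathbb{N}$;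 it is stable if $c(u)<|N_u|$ for all $u$. Starting from a configuration, at each parallel time step every cell $u$ that contains at least $|N_u|$ grains and that has not toppled at an earlier step topples: it loses $|N_u|$ grains and sends $N_u(\delta)$ grains to $u+\delta$ for each $\delta$; grains sent outside $V$ are lost. A cell topples (starting from a given configuration) if it topples at some step. Crossing gate. Let $X,X'$ be two opposite edges of the grid and $Y,Y'$ be the other two opposite edges (so $\{\{X,X'\},\{Y,Y'\}\}=\{\{\text{North},\text{South}\},\{\text{West},\text{East}\}\}$; any choice of directions is allowed). A stable configuration $c$ is a crossing gate if, for some such choice, there are a non-corner cell $x\in X$, a cell $x'\in X'$, a non-corner cell $y\in Y$ and a cell $y'\in Y'$ such that: starting from $c$ with one grain added at $x$, the cell $x'$ topples and no cell of $Y'$ topples; and starting from $c$ with one grain added at $y$, the cell $y'$ topples and no cell of $X'$ topples. A grid admits a crossing gate if some stable configuration on it is a crossing gate. *)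

theory Defs
  imports "HOL-Library.Multiset" "HOL-Library.Product_Plus"
begin

type_synonym cell = "int \<times> int"

type_synonym neighborhood = "cell multiset"

definition is_neighborhood :: "neighborhood \<Rightarrow> bool" where
  "is_neighborhood N \<longleftrightarrow> N \<noteq> {#} \<and> (0, 0) \<notin># N"

text \<open>The neighborhood \<open>A\<^sup>p B\<^sup>q\<close>.\<close>

definition mix :: "nat \<Rightarrow> nat \<Rightarrow> neighborhood \<Rightarrow> neighborhood \<Rightarrow> neighborhood" where
  "mix p q A B = repeat_mset p A + repeat_mset q B"

text \<open>The values of \<open>nbh\<close>, and of configurations, at positions that are not cells of the grid
  are irrelevant: no definition below depends on them.\<close>

record grid =
  width :: nat
  height :: nat
  nbh :: "cell \<Rightarrow> neighborhood"

definition cells :: "grid \<Rightarrow> cell set" where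
  "cells G = {1..int (width G)} \<times> {1..int (height G)}"

definition is_grid :: "grid \<Rightarrow> bool" where
  "is_grid G \<longleftrightarrow> 1 \<le> width G \<and> 1 \<le> height G \<and> (\<forall>u\<in>cells G. is_neighborhood (nbh G u))"

definition uniform_grid :: "neighborhood \<Rightarrow> grid \<Rightarrow> bool" where
  "uniform_grid N G \<longleftrightarrow> is_grid G \<and> (\<forall>u\<in>cells G. nbh G u = N)"

definition nonuniform_grid :: "neighborhood \<Rightarrow> neighborhood \<Rightarrow> grid \<Rightarrow> bool" where
  "nonuniform_grid A B G \<longleftrightarrow> is_grid G \<and> (\<forall>u\<in>cells G. nbh G u \<in> {A, B})"

datatype direction = North | South | West | East

fun opposite :: "direction \<Rightarrow> direction" where
  "opposite North = South"
| "opposite South = North"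
| "opposite West = East"
| "opposite East = West"

definition orthogonal_dirs :: "direction \<Rightarrow> direction \<Rightarrow> bool" where
  "orthogonal_dirs X Y \<longleftrightarrow> (X \<in> {North, South} \<longleftrightarrow> Y \<in> {West, East})"

fun edge :: "grid \<Rightarrow> direction \<Rightarrow> cell set" where
  "edge G West = {u \<in> cells G. fst u = 1}"
| "edge G East = {u \<in> cells G. fst u = int (width G)}"
| "edge G South = {u \<in> cells G. snd u = 1}"
| "edge G North = {u \<in> cells G. snd u = int (height G)}"

definition corners :: "grid \<Rightarrow> cell set" where
  "corners G = {u. \<exists>X Y. orthogonal_dirs X Y \<and> u \<in> edge G X \<and> u \<in> edge G Y}"

type_synonym configuration = "cell \<Rightarrow> nat"

definition stable :: "grid \<Rightarrow> configuration \<Rightarrow> bool" where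
  "stable G c \<longleftrightarrow> (\<forall>u\<in>cells G. c u < size (nbh G u))"

definition add_grain :: "cell \<Rightarrow> configuration \<Rightarrow> configuration" where
  "add_grain x c = c(x := c x + 1)"

text \<open>A state of the dynamics consists of the current configuration and the set of the cells
  that have already toppled.\<close>

type_synonym state = "configuration \<times> cell set"

fun firing :: "grid \<Rightarrow> state \<Rightarrow> cell set" where
  "firing G (c, D) = {u \<in> cells G. u \<notin> D \<and> size (nbh G u) \<le> c u}"

fun step :: "grid \<Rightarrow> state \<Rightarrow> state" where
  "step G (c, D) =
    (let F = firing G (c, D) in
      (\<lambda>u. if u \<in> cells G
            then (c u - (if u \<in> F then size (nbh G u) else 0)) + (\<Sum>v\<in>F. count (nbh G v) (u - v))
            else 0,
       D \<union> F))"

definition topples :: "grid \<Rightarrow> configuration \<Rightarrow> cell \<Rightarrow> bool" where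
  "topples G c u \<longleftrightarrow> (\<exists>t. u \<in> firing G ((step G ^^ t) (c, {})))"

definition crossing_gate :: "grid \<Rightarrow> configuration \<Rightarrow> bool" where
  "crossing_gate G c \<longleftrightarrow> stable G c \<and>
    (\<exists>X Y. orthogonal_dirs X Y \<and>
      (\<exists>x \<in> edge G X - corners G. \<exists>x' \<in> edge G (opposite X).
       \<exists>y \<in> edge G Y - corners G. \<exists>y' \<in> edge G (opposite Y).
         topples G (add_grain x c) x' \<and>
         (\<forall>u \<in> edge G (opposite Y). \<not> topples G (add_grain x c) u) \<and>
         topples G (add_grain y c) y' \<and>
         (\<forall>u \<in> edge G (opposite X). \<not> topples G (add_grain y c) u)))"

definition admits_crossing_gate :: "grid \<Rightarrow> bool" where
  "admits_crossing_gate G \<longleftrightarrow> (\<exists>c. crossing_gate G c)"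

end

(*
Let P be the set of the cells that topple when a grain is added at x but not when it is added
at y, and Q the set defined the other way round. A cell of P other than x receives strictly more
grains from P than from Q, and symmetrically for Q, so a crossing gate yields a path in P from
x to x' and a path in Q from y to y'.

All neighborhoods below lie in {(1,1), (0,1), (-1,1)}: grains move up one row at a time, so an
avalanche from West to East and one from South to North must exchange their left-to-right order
between two consecutive rows. This is possible only if adjacent cells v = (p,j) in one set and
w = (p+1,j) in the other send their grains crosswise, and (p+1,j+1) must then receive more from v
than from w, and (p,j+1) more from w than from v:
N_v(1,1) > N_w(0,1) and N_w(-1,1) > N_v(0,1).

With A = (1,1)^2 and B = (0,1)(-1,1) this holds for N_v = A and N_w = B, but not for
N_v = N_w = A^p B^q, where N_w(-1,1) = q = N_v(0,1).
With A = (1,1)(0,1)(-1,1)^2 and B = (1,1) it holds for N_v = N_w = A B, but not for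
N_v, N_w in {A, B}: N_w(-1,1) > 0 forces N_w = A, and then N_v(1,1) = 1 = N_w(0,1).
*)
theory Submission
  imports Defs
begin

section \<open>Grains received from a set of cells\<close>

definition received :: "grid \<Rightarrow> cell set \<Rightarrow> cell \<Rightarrow> nat" where
  "received G S u = (\<Sum>v\<in>S. count (nbh G v) (u - v))"

definition toppled :: "grid \<Rightarrow> configuration \<Rightarrow> cell set" where
  "toppled G c = {u. topples G c u}"

definition state_at :: "grid \<Rightarrow> configuration \<Rightarrow> nat \<Rightarrow> state" where
  "state_at G c t = (step G ^^ t) (c, {})"

lemma add_grain_apply: "add_grain x c u = (if u = x then c u + 1 else c u)"
  by (simp add: add_grain_def)

lemma finite_cells [simp]: "finite (cells G)"
  by (simp add: cells_def)

lemma received_mono: "finite T \<Longrightarrow> S \<subseteq> T \<Longrightarrow> received G S u \<le> received G T u"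
  unfolding received_def by (rule sum_mono2) auto

text \<open>Cells common to \<open>S\<close> and \<open>T\<close> contribute equally to both sides
  and cancel.\<close>

lemma received_Diff_less:
  assumes "finite S" "finite T" "received G S u < received G T u"
  shows "received G (S - T) u < received G (T - S) u"
proof -
  have "received G R u = received G (R \<inter> R') u + received G (R - R') u" if "finite R" for R R'
    unfolding received_def by (rule sum.Int_Diff[OF that])
  from this[of S T] this[of T S] assms show ?thesis by (simp add: Int_commute)
qed

lemma received_pos:
  assumes "0 < received G S u"
  obtains v where "v \<in> S" "u - v \<in># nbh G v"
proof -
  have "\<exists>v\<in>S. count (nbh G v) (u - v) \<noteq> 0"
    using assms by (rule contrapos_pp) (auto simp: received_def count_eq_zero_iff intro!: sum.neutral)
  then show thesis using that by auto
qed

subsection \<open>The set of toppled cells\<close>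

lemma state_at_0 [simp]: "state_at G c 0 = (c, {})"
  by (simp add: state_at_def)

lemma state_at_Suc: "state_at G c (Suc t) = step G (state_at G c t)"
  by (simp add: state_at_def)

lemma snd_step: "snd (step G s) = snd s \<union> firing G s"
  by (cases s) (simp add: Let_def)

lemma snd_state_at_subset_cells: "snd (state_at G c t) \<subseteq> cells G"
proof (induction t)
  case (Suc t)
  have "firing G (state_at G c t) \<subseteq> cells G" by (cases "state_at G c t") auto
  with Suc show ?case by (simp add: state_at_Suc snd_step)
qed simp

lemma snd_state_at_mono: "s \<le> t \<Longrightarrow> snd (state_at G c s) \<subseteq> snd (state_at G c t)"
  by (rule lift_Suc_mono_le[of "\<lambda>t. snd (state_at G c t)"]) (simp_all add: state_at_Suc snd_step)

text \<open>Each cell topples at most once, so the history matters only through the set of toppled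
  cells. A cell outside this set has lost nothing, and the cells firing at a step are disjoint from
  those that toppled before.\<close>

lemma fst_state_at:
  assumes "u \<in> cells G" "u \<notin> snd (state_at G c t)"
  shows "fst (state_at G c t) u = c u + received G (snd (state_at G c t)) u"
  using assms(2)
proof (induction t)
  case 0
  then show ?case by (simp add: received_def)
next
  case (Suc t)
  obtain c' D where s: "state_at G c t = (c', D)" by fastforce
  have fin: "finite D" using snd_state_at_subset_cells[of G c t] s finite_subset by fastforce
  have finF: "finite (firing G (c', D))" by (rule finite_subset[OF _ finite_cells[of G]]) auto
  have u: "u \<notin> D" "u \<notin> firing G (c', D)"
    using Suc.prems by (simp_all add: state_at_Suc snd_step s del: firing.simps step.simps)
  have "received G (D \<union> firing G (c', D)) u = received G D u + received G (firing G (c', D)) u"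
    unfolding received_def by (rule sum.union_disjoint[OF fin finF]) auto
  moreover have "c' u = c u + received G D u" using Suc.IH u s by simp
  ultimately show ?case
    using u(2) assms(1) by (simp add: state_at_Suc s Let_def received_def del: firing.simps)
qed

lemma toppled_eq_Union: "toppled G c = (\<Union>t. snd (state_at G c t))"
proof (intro equalityI subsetI)
  fix u assume "u \<in> toppled G c"
  then obtain t where "u \<in> firing G (state_at G c t)"
    by (auto simp: toppled_def topples_def state_at_def)
  then have "u \<in> snd (state_at G c (Suc t))" by (simp add: state_at_Suc snd_step)
  then show "u \<in> (\<Union>t. snd (state_at G c t))" by blast
next
  fix u assume "u \<in> (\<Union>t. snd (state_at G c t))"
  then obtain t where "u \<in> snd (state_at G c t)" by blast
  then have "\<exists>s. u \<in> firing G (state_at G c s)"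
    by (induction t) (auto simp: state_at_Suc snd_step)
  then show "u \<in> toppled G c" by (auto simp: toppled_def topples_def state_at_def)
qed

lemma toppled_subset_cells: "toppled G c \<subseteq> cells G"
  using snd_state_at_subset_cells by (auto simp: toppled_eq_Union)

lemma finite_toppled [simp]: "finite (toppled G c)"
  using toppled_subset_cells finite_cells by (rule finite_subset)

lemma toppled_reached: "\<exists>t. snd (state_at G c t) = toppled G c"
proof -
  have "\<forall>u\<in>toppled G c. \<exists>t. u \<in> snd (state_at G c t)" by (auto simp: toppled_eq_Union)
  then obtain f where f: "\<And>u. u \<in> toppled G c \<Longrightarrow> u \<in> snd (state_at G c (f u))" by metis
  \<comment> \<open>The sum of the finitely many times is a common upper bound for them.\<close>
  have "toppled G c \<subseteq> snd (state_at G c (\<Sum>u\<in>toppled G c. f u))"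
  proof
    fix u assume u: "u \<in> toppled G c"
    then have "f u \<le> (\<Sum>u\<in>toppled G c. f u)" by (simp add: member_le_sum)
    from snd_state_at_mono[OF this] f[OF u] show "u \<in> snd (state_at G c (\<Sum>u\<in>toppled G c. f u))"
      by blast
  qed
  then show ?thesis by (auto simp: toppled_eq_Union)
qed

text \<open>This replaces the dynamics by a fixed-point equation. When \<open>u\<close> fires, its
  grains come from part of the final set, which bounds them from above; conversely, once the final
  set is reached, an untoppled cell with enough grains would fire.\<close>

lemma toppled_iff:
  assumes "u \<in> cells G"
  shows "u \<in> toppled G c \<longleftrightarrow> size (nbh G u) \<le> c u + received G (toppled G c) u"
proof
  assume "u \<in> toppled G c"
  then obtain t where "u \<in> firing G (state_at G c t)"
    by (auto simp: toppled_def topples_def state_at_def)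
  then have "u \<notin> snd (state_at G c t)" "size (nbh G u) \<le> fst (state_at G c t) u"
    by (cases "state_at G c t", simp)+
  then have "size (nbh G u) \<le> c u + received G (snd (state_at G c t)) u"
    using fst_state_at[OF assms] by simp
  also have "\<dots> \<le> c u + received G (toppled G c) u"
    by (intro add_left_mono received_mono finite_toppled) (auto simp: toppled_eq_Union)
  finally show "size (nbh G u) \<le> c u + received G (toppled G c) u" .
next
  assume *: "size (nbh G u) \<le> c u + received G (toppled G c) u"
  obtain t where t: "snd (state_at G c t) = toppled G c" using toppled_reached by blast
  show "u \<in> toppled G c"
  proof (rule ccontr)
    assume u: "u \<notin> toppled G c"
    then have "size (nbh G u) \<le> fst (state_at G c t) u" using * fst_state_at[OF assms] t by simp
    then have "u \<in> firing G (state_at G c t)" using u t assms by (cases "state_at G c t") simp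
    then show False using u by (auto simp: toppled_def topples_def state_at_def)
  qed
qed

text \<open>As long as only cells of \<open>S\<close> have toppled, no cell outside \<open>S\<close>
  can reach its threshold, so none ever fires.\<close>

lemma toppled_subset_if_closed:
  assumes "finite S"
    and closed: "\<And>u. u \<in> cells G - S \<Longrightarrow> c u + received G S u < size (nbh G u)"
  shows "toppled G c \<subseteq> S"
proof -
  have "snd (state_at G c t) \<subseteq> S" for t
  proof (induction t)
    case (Suc t)
    have "u \<in> S" if u: "u \<in> firing G (state_at G c t)" for u
    proof (rule ccontr)
      assume "u \<notin> S"
      have f: "u \<in> cells G" "u \<notin> snd (state_at G c t)"
          "size (nbh G u) \<le> fst (state_at G c t) u"
        using u by (cases "state_at G c t", simp)+
      with received_mono[OF assms(1) Suc, of G u] closed[of u] \<open>u \<notin> S\<close> fst_state_at[OF f(1,2)]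
      show False by simp
    qed
    then show ?case using Suc by (auto simp: state_at_Suc snd_step)
  qed simp
  then show ?thesis by (auto simp: toppled_eq_Union)
qed

text \<open>Cells receiving nothing from \<open>S\<close> stay below their threshold by stability,
  and the added grain lies in \<open>S\<close>. Only the targets of grains sent by \<open>S\<close>
  remain to be checked, a finite computation for a concrete path.\<close>

lemma toppled_add_grain_subset:
  assumes "stable G c" "finite S" "x \<in> S"
    and frontier: "\<forall>v\<in>S. \<forall>d\<in>set_mset (nbh G v). v + d \<in> cells G \<longrightarrow> v + d \<notin> S \<longrightarrow>
      c (v + d) + received G S (v + d) < size (nbh G (v + d))"
  shows "toppled G (add_grain x c) \<subseteq> S"
proof (rule toppled_subset_if_closed[OF assms(2)])
  fix u assume u: "u \<in> cells G - S"
  have "c u + received G S u < size (nbh G u)"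
  proof (cases "received G S u = 0")
    case True
    then show ?thesis using assms(1) u by (simp add: stable_def)
  next
    case False
    then obtain v where "v \<in> S" "u - v \<in># nbh G v" using received_pos[of G S u] by blast
    then show ?thesis using frontier[rule_format, of v "u - v"] u by simp
  qed
  then show "add_grain x c u + received G S u < size (nbh G u)"
    using assms(3) u by (auto simp: add_grain_def)
qed

lemma toppled_source:
  assumes "x \<in> cells G" "size (nbh G x) \<le> Suc (c x)"
  shows "x \<in> toppled G (add_grain x c)"
  using assms by (simp add: toppled_iff add_grain_def)

lemma toppled_propagates:
  assumes "v \<in> toppled G c" "u \<in> cells G" "size (nbh G u) \<le> c u + count (nbh G v) (u - v)"
  shows "u \<in> toppled G c"
proof -
  have "count (nbh G v) (u - v) \<le> received G (toppled G c) u"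
    unfolding received_def by (rule member_le_sum) (use assms(1) in auto)
  then show ?thesis using assms by (simp add: toppled_iff)
qed

text \<open>Away from \<open>x\<close> the first run starts with no more grains than the second, yet
  \<open>u\<close> topples only in the first. By \<open>toppled_iff\<close> it receives more there,
  and common senders cancel.\<close>

lemma received_less_of_toppled_Diff:
  assumes "u \<in> toppled G (add_grain x c) - toppled G (add_grain y c)" "u \<noteq> x"
  shows "received G (toppled G (add_grain y c) - toppled G (add_grain x c)) u
       < received G (toppled G (add_grain x c) - toppled G (add_grain y c)) u"
proof (rule received_Diff_less)
  have u: "u \<in> cells G" using assms toppled_subset_cells by blast
  show "received G (toppled G (add_grain y c)) u < received G (toppled G (add_grain x c)) u"
    using assms toppled_iff[OF u, of "add_grain x c"] toppled_iff[OF u, of "add_grain y c"]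
    by (auto simp: add_grain_def split: if_splits)
qed simp_all

lemma received_pos_of_toppled:
  assumes "stable G c" "u \<in> toppled G (add_grain x c)" "u \<noteq> x"
  shows "0 < received G (toppled G (add_grain x c)) u"
proof -
  have u: "u \<in> cells G" using assms toppled_subset_cells by blast
  show ?thesis
    using assms toppled_iff[OF u, of "add_grain x c"] u
    by (auto simp: add_grain_def stable_def)
qed

subsection \<open>Grids in which all grains move up by one row\<close>

definition upward_grid :: "grid \<Rightarrow> bool" where
  "upward_grid G \<longleftrightarrow> (\<forall>u\<in>cells G. set_mset (nbh G u) \<subseteq> {(1, 1), (0, 1), (-1, 1)})"

text \<open>Ranging over all pairs of cells, adjacent or not, makes this a condition on the
  neighborhoods occurring in the grid. Equality already blocks, since the inequalities between
  received grains are strict.\<close>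

definition no_crosswise_sending :: "grid \<Rightarrow> bool" where
  "no_crosswise_sending G \<longleftrightarrow> (\<forall>v\<in>cells G. \<forall>w\<in>cells G.
      count (nbh G v) (1, 1) \<le> count (nbh G w) (0, 1) \<or>
      count (nbh G w) (-1, 1) \<le> count (nbh G v) (0, 1))"

text \<open>This holds vacuously on a row that \<open>P\<close> or \<open>Q\<close> misses, so a
  contradiction also requires both sets to meet the row in question.\<close>

definition left_of :: "cell set \<Rightarrow> cell set \<Rightarrow> int \<Rightarrow> bool" where
  "left_of P Q j \<longleftrightarrow> (\<forall>a b. (a, j) \<in> P \<longrightarrow> (b, j) \<in> Q \<longrightarrow> a < b)"

lemma upward_cell:
  assumes "upward_grid G" "v \<in> cells G" "(a, j) - v \<in># nbh G v"
  shows "(fst v, j - 1) = v" "a - 1 \<le> fst v" "fst v \<le> a + 1"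
proof -
  have "(a, j) - v \<in> {(1, 1), (0, 1), (-1, 1)}" using assms unfolding upward_grid_def by blast
  then show "(fst v, j - 1) = v" "a - 1 \<le> fst v" "fst v \<le> a + 1" by (cases v, auto)+
qed

lemma received_pos_upward:
  assumes "upward_grid G" "S \<subseteq> cells G" "0 < received G S (a, j)"
  obtains p where "(p, j - 1) \<in> S" "a - 1 \<le> p" "p \<le> a + 1"
proof -
  obtain v where v: "v \<in> S" "(a, j) - v \<in># nbh G v" by (rule received_pos[OF assms(3)])
  then show thesis using that[of "fst v"] upward_cell[OF assms(1), of v a j] assms(2) by auto
qed

lemma received_single_parent:
  assumes "upward_grid G" "finite S" "S \<subseteq> cells G" "(p, j - 1) \<in> S"
    "\<And>q. (q, j - 1) \<in> S \<Longrightarrow> a - 1 \<le> q \<Longrightarrow> q \<le> a + 1 \<Longrightarrow> q = p"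
  shows "received G S (a, j) = count (nbh G (p, j - 1)) (a - p, 1)"
proof -
  have "received G S (a, j) = (\<Sum>v\<in>{(p, j - 1)}. count (nbh G v) ((a, j) - v))"
    unfolding received_def
  proof (rule sum.mono_neutral_right)
    show "\<forall>v\<in>S - {(p, j - 1)}. count (nbh G v) ((a, j) - v) = 0"
    proof (intro ballI, rule ccontr)
      fix v assume v: "v \<in> S - {(p, j - 1)}" and "count (nbh G v) ((a, j) - v) \<noteq> 0"
      then have "(a, j) - v \<in># nbh G v" by auto
      then show False
        using upward_cell[OF assms(1), of v a j] assms(3) assms(5)[of "fst v"] v by auto
    qed
  qed (use assms in auto)
  then show ?thesis by simp
qed

lemma received_ge_parent:
  assumes "finite S" "(p, j - 1) \<in> S"
  shows "count (nbh G (p, j - 1)) (a - p, 1) \<le> received G S (a, j)"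
proof -
  have "count (nbh G (p, j - 1)) ((a, j) - (p, j - 1)) \<le> received G S (a, j)"
    unfolding received_def by (rule member_le_sum) (use assms in auto)
  then show ?thesis by simp
qed

text \<open>The order can only be reversed by two adjacent cells \<open>(p, j - 1)\<close> and \<open>(p + 1, j - 1)\<close>
  sending their grains crosswise, which is excluded.\<close>

lemma left_of_preserved:
  assumes up: "upward_grid G" and blocked: "no_crosswise_sending G"
    and PQ: "P \<subseteq> cells G" "Q \<subseteq> cells G" "P \<inter> Q = {}"
    and P: "\<And>a. (a, j) \<in> P \<Longrightarrow> received G Q (a, j) < received G P (a, j)"
    and Q: "\<And>b. (b, j) \<in> Q \<Longrightarrow> received G P (b, j) < received G Q (b, j)"
    and left: "left_of P Q (j - 1)"
  shows "left_of P Q j"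
  unfolding left_of_def
proof (intro allI impI, rule ccontr)
  fix a b assume a: "(a, j) \<in> P" and b: "(b, j) \<in> Q" and "\<not> a < b"
  then have "b < a" using PQ(3) by (metis disjoint_iff linorder_neqE)
  have fin: "finite P" "finite Q" using PQ finite_cells finite_subset by blast+
  obtain p where p: "(p, j - 1) \<in> P" "a - 1 \<le> p"
    by (rule received_pos_upward[OF up PQ(1), of a j]) (use P[OF a] in auto)
  obtain q where q: "(q, j - 1) \<in> Q" "q \<le> b + 1"
    by (rule received_pos_upward[OF up PQ(2), of b j]) (use Q[OF b] in auto)
  have lt: "p' < q'" if "(p', j - 1) \<in> P" "(q', j - 1) \<in> Q" for p' q'
    using left that by (auto simp: left_of_def)
  \<comment> \<open>Senders are at most one column away, so
    \<open>a \<le> p + 1 \<le> q \<le> b + 1 \<le> a\<close>.\<close>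
  have eq: "a = p + 1" "q = p + 1" "b = p" using lt[OF p(1) q(1)] p(2) q(2) \<open>b < a\<close> by auto
  \<comment> \<open>Cells of \<open>P\<close> in the lower row lie left of \<open>q = a\<close>, so
    \<open>p = a - 1\<close> is the only one within reach of \<open>a\<close>. Symmetrically,
    \<open>q\<close> is the only cell of \<open>Q\<close> within reach of \<open>b\<close>.\<close>
  have "received G P (a, j) = count (nbh G (p, j - 1)) (a - p, 1)"
    by (rule received_single_parent[OF up fin(1) PQ(1) p(1)])
      (use lt[OF _ q(1)] eq in fastforce)
  moreover have "received G Q (b, j) = count (nbh G (q, j - 1)) (b - q, 1)"
    by (rule received_single_parent[OF up fin(2) PQ(2) q(1)])
      (use lt[OF p(1)] eq in fastforce)
  moreover note received_ge_parent[OF fin(2) q(1), of G a] received_ge_parent[OF fin(1) p(1), of G b]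
    P[OF a] Q[OF b]
  moreover have "count (nbh G (p, j - 1)) (1, 1) \<le> count (nbh G (q, j - 1)) (0, 1) \<or>
      count (nbh G (q, j - 1)) (-1, 1) \<le> count (nbh G (p, j - 1)) (0, 1)"
    using blocked p(1) q(1) PQ unfolding no_crosswise_sending_def by blast
  ultimately show False using eq by auto
qed

text \<open>Every toppled cell other than \<open>x\<close> has a toppled sender one row below. Rows
  start at 1, so following senders downwards must end at \<open>x\<close>.\<close>

lemma toppled_above_source:
  assumes "upward_grid G" "stable G c"
  shows "u \<in> toppled G (add_grain x c) \<Longrightarrow> u \<noteq> x \<Longrightarrow> snd x < snd u"
proof (induction "nat (snd u)" arbitrary: u rule: less_induct)
  case less
  obtain a j where u: "u = (a, j)" by fastforce
  obtain p where p: "(p, j - 1) \<in> toppled G (add_grain x c)"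
    by (rule received_pos_upward[OF assms(1) toppled_subset_cells])
      (use received_pos_of_toppled[OF assms(2) less.prems] u in auto)
  then have "1 \<le> j - 1" using toppled_subset_cells[of G "add_grain x c"]
    by (auto simp: cells_def)
  then show ?case using less.hyps[of "(p, j - 1)"] p u by (cases "(p, j - 1) = x") auto
qed

section \<open>Impossibility of crossing gates\<close>

lemma no_crossing:
  assumes up: "upward_grid G" and blocked: "no_crosswise_sending G"
    and c: "stable G c" and X: "X \<in> {West, East}" and Y: "Y \<in> {North, South}"
    and x: "x \<in> edge G X - corners G" and x': "x' \<in> edge G (opposite X)"
    and y: "y \<in> edge G Y - corners G" and y': "y' \<in> edge G (opposite Y)"
    and tx: "x' \<in> toppled G (add_grain x c)"
      "\<And>u. u \<in> edge G (opposite Y) \<Longrightarrow> u \<notin> toppled G (add_grain x c)"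
    and ty: "y' \<in> toppled G (add_grain y c)"
      "\<And>u. u \<in> edge G (opposite X) \<Longrightarrow> u \<notin> toppled G (add_grain y c)"
  shows False
proof -
  define P where "P = toppled G (add_grain x c) - toppled G (add_grain y c)"
  define Q where "Q = toppled G (add_grain y c) - toppled G (add_grain x c)"
  have sub: "P \<subseteq> cells G" "Q \<subseteq> cells G" and disj: "P \<inter> Q = {}" "Q \<inter> P = {}"
    using toppled_subset_cells by (auto simp: P_def Q_def)
  have P: "received G Q u < received G P u" if "u \<in> P" "u \<noteq> x" for u
    using received_less_of_toppled_Diff that unfolding P_def Q_def by blast
  have Q: "received G P u < received G Q u" if "u \<in> Q" "u \<noteq> y" for u
    using received_less_of_toppled_Diff that unfolding P_def Q_def by blast
  have xX: "x \<in> edge G X" and xc: "x \<in> cells G" using x X by auto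
  \<comment> \<open>Not being a corner keeps \<open>x\<close> off the bottom and top rows, so the
    height is at least 3 and a source on the South edge lies strictly below
    \<open>x\<close>.\<close>
  have "snd x \<noteq> 1 \<and> snd x \<noteq> int (height G)"
  proof (rule ccontr)
    assume "\<not> ?thesis"
    then have "x \<in> edge G South \<or> x \<in> edge G North" using xc by auto
    then obtain Z where "Z \<in> {North, South}" "x \<in> edge G Z" by blast
    then have "x \<in> corners G" using xX X by (auto simp: corners_def orthogonal_dirs_def)
    then show False using x by blast
  qed
  then have rx: "1 < snd x" "snd x < int (height G)" using xc by (auto simp: cells_def)
  \<comment> \<open>Avalanches only move up, so \<open>y\<close> cannot be on the North edge with
    \<open>y'\<close> on the South edge.\<close>
  have "snd y \<le> snd y'"
    using toppled_above_source[OF up c ty(1)] by (cases "y' = y") auto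
  then have South: "Y = South" using Y y y' rx by auto
  have ry: "snd y = 1" using y South by simp
  \<comment> \<open>Starting from \<open>y'\<close> in the top row, senders in \<open>Q\<close> are
    followed downwards; \<open>k\<close> is the distance from the top. Only the bottom row can
    contain \<open>y\<close>, so a sender exists at each step.\<close>
  have *: "\<exists>b. (b, int (height G) - int k) \<in> Q" if "int k < int (height G)" for k
    using that
  proof (induction k)
    case 0
    have "y' \<in> Q" using ty(1) tx(2)[OF y'] by (simp add: Q_def)
    then show ?case using y' South by (intro exI[of _ "fst y'"]) (cases y', simp)
  next
    case (Suc k)
    then obtain b where b: "(b, int (height G) - int k) \<in> Q" by auto
    moreover have "(b, int (height G) - int k) \<noteq> y" using ry Suc.prems by auto
    ultimately have "0 < received G Q (b, int (height G) - int k)" using Q by fastforce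
    then obtain p where "(p, int (height G) - int k - 1) \<in> Q"
      by (rule received_pos_upward[OF up sub(2)])
    then show ?case by (intro exI[of _ p]) (simp add: algebra_simps)
  qed
  have Qrow: "\<exists>b. (b, j) \<in> Q" if "1 \<le> j" "j \<le> int (height G)" for j
  proof -
    have "int (nat (int (height G) - j)) = int (height G) - j" using that by simp
    with *[of "nat (int (height G) - j)"] that show ?thesis by simp
  qed
  have Prow: "snd x \<le> snd u \<and> (snd u = snd x \<longrightarrow> u = x)" if "u \<in> P" for u
  proof (cases "u = x")
    case False
    then have "snd x < snd u" using toppled_above_source[OF up c] that by (simp add: P_def)
    then show ?thesis by simp
  qed simp
  \<comment> \<open>Rows strictly above \<open>x\<close> contain neither source, so the strict
    inequalities hold for all cells of \<open>P\<close> and \<open>Q\<close> there.\<close>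
  have Pstep: "received G Q (a, snd x + int (Suc k)) < received G P (a, snd x + int (Suc k))"
    if "(a, snd x + int (Suc k)) \<in> P" for a k
    using that by (intro P) (auto simp: prod_eq_iff)
  have Qstep: "received G P (a, snd x + int (Suc k)) < received G Q (a, snd x + int (Suc k))"
    if "(a, snd x + int (Suc k)) \<in> Q" for a k
    using that ry rx by (intro Q) (auto simp: prod_eq_iff)
  have "x' \<in> P" using tx(1) ty(2)[OF x'] by (simp add: P_def)
  then have x'c: "x' \<in> cells G" and "snd x \<le> snd x'" using sub Prow by auto
  then obtain k where k: "snd x' = snd x + int k" using zle_iff_zadd by blast
  obtain b where b: "(b, snd x') \<in> Q"
    using Qrow[of "snd x'"] x'c by (auto simp: cells_def)
  have bc: "1 \<le> b" "b \<le> int (width G)" using b sub(2) by (auto simp: cells_def)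
  have x'P: "(fst x', snd x') \<in> P" using \<open>x' \<in> P\<close> by simp
  have Qx: "1 \<le> a" "a \<le> int (width G)" "(a, snd x) \<notin> P" if "(a, snd x) \<in> Q" for a
    using that sub(2) disj by (auto simp: cells_def)
  have Px: "a = fst x" if "(a, snd x) \<in> P" for a
    using Prow[OF that] by (metis fst_conv snd_conv)
  show False
  proof (cases "X = West")
    case True
    \<comment> \<open>In the row of \<open>x\<close>, the set \<open>P\<close> has no cell but
      \<open>x\<close>, which is in the first column. The order is carried up to the row of
      \<open>x'\<close>, where a cell of \<open>Q\<close> would have to lie beyond the last
      column.\<close>
    have "left_of P Q (snd x + int k)" for k
    proof (induction k)
      case 0
      have "a < b" if "(a, snd x) \<in> P" "(b, snd x) \<in> Q" for a b
        using Px[OF that(1)] xX True Qx[OF that(2)] that(1) by (cases "a = b") auto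
      then show ?case by (simp add: left_of_def)
    next
      case (Suc k)
      show ?case
        by (rule left_of_preserved[OF up blocked sub disj(1)], erule Pstep, erule Qstep) (use Suc in simp)
    qed
    then have "fst x' < b" using b x'P unfolding left_of_def k by blast
    then show False using bc x' True by simp
  next
    case False
    then have East: "X = East" using X by simp
    have "left_of Q P (snd x + int k)" for k
    proof (induction k)
      case 0
      have "b < a" if "(a, snd x) \<in> P" "(b, snd x) \<in> Q" for a b
        using Px[OF that(1)] xX East Qx[OF that(2)] that(1) by (cases "a = b") auto
      then show ?case by (simp add: left_of_def)
    next
      case (Suc k)
      show ?case
        by (rule left_of_preserved[OF up blocked sub(2,1) disj(2)], erule Qstep, erule Pstep) (use Suc in simp)
    qed
    then have "b < fst x'" using b x'P unfolding left_of_def k by blast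
    then show False using bc x' East by simp
  qed
qed

lemma no_crossing_gate:
  assumes "upward_grid G" "no_crosswise_sending G"
  shows "\<not> admits_crossing_gate G"
proof
  assume "admits_crossing_gate G"
  then obtain c X Y x x' y y' where *: "stable G c" "orthogonal_dirs X Y"
    "x \<in> edge G X - corners G" "x' \<in> edge G (opposite X)"
    "y \<in> edge G Y - corners G" "y' \<in> edge G (opposite Y)"
    "x' \<in> toppled G (add_grain x c)"
    "\<And>u. u \<in> edge G (opposite Y) \<Longrightarrow> u \<notin> toppled G (add_grain x c)"
    "y' \<in> toppled G (add_grain y c)"
    "\<And>u. u \<in> edge G (opposite X) \<Longrightarrow> u \<notin> toppled G (add_grain y c)"
    unfolding admits_crossing_gate_def crossing_gate_def toppled_def by blast
  have "X \<in> {West, East} \<and> Y \<in> {North, South} \<or> Y \<in> {West, East} \<and> X \<in> {North, South}"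
    using *(2) by (cases X; cases Y; simp add: orthogonal_dirs_def)
  then show False
  proof
    assume "X \<in> {West, East} \<and> Y \<in> {North, South}"
    then show False using no_crossing[OF assms, of c X Y x x' y y'] * by blast
  next
    assume "Y \<in> {West, East} \<and> X \<in> {North, South}"
    then show False using no_crossing[OF assms, of c Y X y y' x x'] * by blast
  qed
qed

section \<open>The two families of grids without crossing gates\<close>

lemma no_crossing_gate_mix:
  assumes "uniform_grid (mix p q {#(1, 1), (1, 1)#} {#(0, 1), (-1, 1)#}) G"
  shows "\<not> admits_crossing_gate G"
proof (rule no_crossing_gate)
  show "upward_grid G" "no_crosswise_sending G"
    using assms
    by (auto simp: uniform_grid_def mix_def upward_grid_def no_crosswise_sending_def split: if_splits)
qed

lemma no_crossing_gate_nonuniform: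
  assumes "nonuniform_grid {#(1, 1), (0, 1), (-1, 1), (-1, 1)#} {#(1, 1)#} G"
  shows "\<not> admits_crossing_gate G"
proof (rule no_crossing_gate)
  have nbh: "nbh G u = {#(1, 1), (0, 1), (-1, 1), (-1, 1)#} \<or> nbh G u = {#(1, 1)#}"
    if "u \<in> cells G" for u
    using assms that by (auto simp: nonuniform_grid_def)
  show "upward_grid G" unfolding upward_grid_def by (rule ballI, drule nbh) auto
  show "no_crosswise_sending G"
    unfolding no_crosswise_sending_def
  proof (intro ballI)
    fix v w assume "v \<in> cells G" "w \<in> cells G"
    from this[THEN nbh] show "count (nbh G v) (1, 1) \<le> count (nbh G w) (0, 1) \<or>
        count (nbh G w) (-1, 1) \<le> count (nbh G v) (0, 1)"
      by auto
  qed
qed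

subsection \<open>Two crossing gates on \<open>4 \<times> 6\<close> grids\<close>

definition gate_grid :: "(cell \<Rightarrow> neighborhood) \<Rightarrow> grid" where
  "gate_grid N = \<lparr>width = 4, height = 6, nbh = N\<rparr>"

lemma gate_grid_simps [simp]:
  "width (gate_grid N) = 4" "height (gate_grid N) = 6" "nbh (gate_grid N) = N"
  by (simp_all add: gate_grid_def)

lemma in_cells_gate_grid:
  "(a, b) \<in> cells (gate_grid N) \<longleftrightarrow> 1 \<le> a \<and> a \<le> 4 \<and> 1 \<le> b \<and> b \<le> 6"
  by (simp add: cells_def)

text \<open>Supersets \<open>S\<close> and \<open>T\<close> of the avalanches suffice to show that
  they avoid the wrong edge. The exit \<open>y'\<close> is left open because the two gates reach the
  top row in different columns.\<close>

lemma crossing_gate_gate_gridI: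
  assumes "stable (gate_grid N) c"
    and "(4, 5) \<in> toppled (gate_grid N) (add_grain (1, 2) c)"
    and "y' \<in> cells (gate_grid N)" "snd y' = 6" "y' \<in> toppled (gate_grid N) (add_grain (3, 1) c)"
    and "toppled (gate_grid N) (add_grain (1, 2) c) \<subseteq> S" "\<And>u. u \<in> S \<Longrightarrow> snd u \<noteq> 6"
    and "toppled (gate_grid N) (add_grain (3, 1) c) \<subseteq> T" "\<And>u. u \<in> T \<Longrightarrow> fst u \<noteq> 4"
  shows "admits_crossing_gate (gate_grid N)"
proof -
  let ?G = "gate_grid N"
  have corner: "fst u \<in> {1, 4} \<and> snd u \<in> {1, 6}" if u: "u \<in> corners ?G" for u
  proof -
    obtain Z W where "orthogonal_dirs Z W" "u \<in> edge ?G Z" "u \<in> edge ?G W"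
      using u by (auto simp: corners_def)
    then show ?thesis by (cases Z; cases W) (simp_all add: orthogonal_dirs_def)
  qed
  have "(1, 2) \<in> edge ?G West - corners ?G" "(3, 1) \<in> edge ?G South - corners ?G"
    "(4, 5) \<in> edge ?G (opposite West)" "y' \<in> edge ?G (opposite South)"
    using corner[of "(1, 2)"] corner[of "(3, 1)"] assms(3,4) by (auto simp: in_cells_gate_grid)
  moreover have "\<not> topples ?G (add_grain (1, 2) c) u" if "u \<in> edge ?G (opposite South)" for u
    using that assms(6) assms(7)[of u] by (auto simp: toppled_def)
  moreover have "\<not> topples ?G (add_grain (3, 1) c) u" if "u \<in> edge ?G (opposite West)" for u
    using that assms(8) assms(9)[of u] by (auto simp: toppled_def)
  moreover have "orthogonal_dirs West South" by (simp add: orthogonal_dirs_def)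
  ultimately show ?thesis
    using assms(1,2,5) unfolding admits_crossing_gate_def crossing_gate_def toppled_def by blast
qed

text \<open>In both gates the avalanche from \<open>(1, 2)\<close> is \<open>east_path\<close>; the other one starts at \<open>(3, 1)\<close>, and
  the crossing is that of \<open>(1, 2) \<rightarrow> (2, 3)\<close> with \<open>(2, 2) \<rightarrow> (1, 3)\<close>.\<close>

abbreviation east_path :: "cell set" where
  "east_path \<equiv> {(1, 2), (2, 3), (3, 4), (4, 5)}"

abbreviation north_path :: "cell set" where
  "north_path \<equiv> {(3, 1), (2, 2), (1, 3), (1, 4), (1, 5), (1, 6)}"

text \<open>With \<open>constant_nbh\<close> only diagonal moves carry two grains, so after reaching
  column 1 this path bounces between columns 1 and 2 instead of going straight up.\<close>

abbreviation zigzag_path :: "cell set" where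
  "zigzag_path \<equiv> {(3, 1), (2, 2), (1, 3), (2, 4), (1, 5), (2, 6)}"

definition mixed_nbh :: "cell \<Rightarrow> neighborhood" where
  "mixed_nbh u = (if u \<in> east_path then {#(1, 1), (1, 1)#} else {#(0, 1), (-1, 1)#})"

text \<open>All thresholds are 2. Cells of \<open>north_path\<close> need one more grain, while
  those of \<open>east_path\<close> after the source need the two that its cells send diagonally;
  the single grain from \<open>(2, 2)\<close> leaves \<open>(2, 3)\<close> stable.\<close>

definition mixed_conf :: configuration where
  "mixed_conf u = (if u \<in> insert (1, 2) north_path then 1 else 0)"

definition constant_nbh :: "cell \<Rightarrow> neighborhood" where
  "constant_nbh u = {#(1, 1), (1, 1), (0, 1), (-1, 1), (-1, 1)#}"

text \<open>The threshold is 5. The sources lack one grain and the other path cells two, so a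
  diagonal move triggers them and the single vertical grain sent between the paths at the crossing
  does not.\<close>

definition constant_conf :: configuration where
  "constant_conf u =
    (if u \<in> {(1, 2), (3, 1)} then 4 else if u \<in> east_path \<union> zigzag_path then 3 else 0)"

lemma stable_mixed: "stable (gate_grid mixed_nbh) mixed_conf"
  by (auto simp: stable_def mixed_nbh_def mixed_conf_def)

lemma stable_constant: "stable (gate_grid constant_nbh) constant_conf"
  by (auto simp: stable_def constant_nbh_def constant_conf_def)

section \<open>The avalanches of the two gates\<close>

context
  notes [simp] = in_cells_gate_grid received_def add_grain_apply mixed_nbh_def mixed_conf_def
    constant_nbh_def constant_conf_def
begin

lemmas mixed_avalanches =
  toppled_add_grain_subset[OF stable_mixed, of east_path "(1, 2)", simplified]
  toppled_add_grain_subset[OF stable_mixed, of north_path "(3, 1)", simplified]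

lemmas constant_avalanches =
  toppled_add_grain_subset[OF stable_constant, of east_path "(1, 2)", simplified]
  toppled_add_grain_subset[OF stable_constant, of zigzag_path "(3, 1)", simplified]

text \<open>Along each path the grains from the preceding cell alone complete the threshold, so
  toppling is passed on one cell at a time.\<close>

lemmas mixed_crossing =
  toppled_source[of "(1, 2)" "gate_grid mixed_nbh" mixed_conf, simplified,
    THEN toppled_propagates[of _ _ _ "(2, 3)"], simplified,
    THEN toppled_propagates[of _ _ _ "(3, 4)"], simplified,
    THEN toppled_propagates[of _ _ _ "(4, 5)"], simplified]
  toppled_source[of "(3, 1)" "gate_grid mixed_nbh" mixed_conf, simplified,
    THEN toppled_propagates[of _ _ _ "(2, 2)"], simplified,
    THEN toppled_propagates[of _ _ _ "(1, 3)"], simplified,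
    THEN toppled_propagates[of _ _ _ "(1, 4)"], simplified,
    THEN toppled_propagates[of _ _ _ "(1, 5)"], simplified,
    THEN toppled_propagates[of _ _ _ "(1, 6)"], simplified]

lemmas constant_crossing =
  toppled_source[of "(1, 2)" "gate_grid constant_nbh" constant_conf, simplified,
    THEN toppled_propagates[of _ _ _ "(2, 3)"], simplified,
    THEN toppled_propagates[of _ _ _ "(3, 4)"], simplified,
    THEN toppled_propagates[of _ _ _ "(4, 5)"], simplified]
  toppled_source[of "(3, 1)" "gate_grid constant_nbh" constant_conf, simplified,
    THEN toppled_propagates[of _ _ _ "(2, 2)"], simplified,
    THEN toppled_propagates[of _ _ _ "(1, 3)"], simplified,
    THEN toppled_propagates[of _ _ _ "(2, 4)"], simplified,
    THEN toppled_propagates[of _ _ _ "(1, 5)"], simplified,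
    THEN toppled_propagates[of _ _ _ "(2, 6)"], simplified]

end

lemma admits_crossing_gate_mixed: "admits_crossing_gate (gate_grid mixed_nbh)"
  by (rule crossing_gate_gate_gridI[OF stable_mixed mixed_crossing(1) _ _ mixed_crossing(2)
        mixed_avalanches(1) _ mixed_avalanches(2)])
    (auto simp: in_cells_gate_grid)

lemma admits_crossing_gate_constant: "admits_crossing_gate (gate_grid constant_nbh)"
  by (rule crossing_gate_gate_gridI[OF stable_constant constant_crossing(1) _ _ constant_crossing(2)
        constant_avalanches(1) _ constant_avalanches(2)])
    (auto simp: in_cells_gate_grid)

theorem mainTheorem3:
  "(\<exists>A B :: neighborhood. is_neighborhood A \<and> is_neighborhood B \<and> A \<noteq> B \<and>
      (\<exists>G. nonuniform_grid A B G \<and> admits_crossing_gate G) \<and>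
      (\<forall>p \<ge> 1. \<forall>q \<ge> 1. \<forall>G. uniform_grid (mix p q A B) G \<longrightarrow> \<not> admits_crossing_gate G)) \<and>
   (\<exists>A B :: neighborhood. is_neighborhood A \<and> is_neighborhood B \<and> A \<noteq> B \<and>
      (\<exists>G. uniform_grid (mix 1 1 A B) G \<and> admits_crossing_gate G) \<and>
      (\<forall>G. nonuniform_grid A B G \<longrightarrow> \<not> admits_crossing_gate G))"
proof (intro conjI)
  let ?A = "{#(1, 1), (1, 1)#} :: neighborhood" and ?B = "{#(0, 1), (-1, 1)#} :: neighborhood"
  have "nonuniform_grid ?A ?B (gate_grid mixed_nbh)"
    by (auto simp: nonuniform_grid_def is_grid_def is_neighborhood_def mixed_nbh_def)
  then have "\<exists>G. nonuniform_grid ?A ?B G \<and> admits_crossing_gate G"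
    using admits_crossing_gate_mixed by blast
  moreover have "is_neighborhood ?A" "is_neighborhood ?B" "?A \<noteq> ?B"
    by (simp_all add: is_neighborhood_def add_eq_conv_ex)
  ultimately show "\<exists>A B :: neighborhood. is_neighborhood A \<and> is_neighborhood B \<and> A \<noteq> B \<and>
      (\<exists>G. nonuniform_grid A B G \<and> admits_crossing_gate G) \<and>
      (\<forall>p \<ge> 1. \<forall>q \<ge> 1. \<forall>G. uniform_grid (mix p q A B) G \<longrightarrow> \<not> admits_crossing_gate G)"
    using no_crossing_gate_mix by blast
next
  let ?A = "{#(1, 1), (0, 1), (-1, 1), (-1, 1)#} :: neighborhood"
    and ?B = "{#(1, 1)#} :: neighborhood"
  have "mix 1 1 ?A ?B = {#(1, 1), (1, 1), (0, 1), (-1, 1), (-1, 1)#}"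
    by (simp add: mix_def)
  then have "uniform_grid (mix 1 1 ?A ?B) (gate_grid constant_nbh)"
    by (simp add: uniform_grid_def is_grid_def is_neighborhood_def constant_nbh_def)
  then have "\<exists>G. uniform_grid (mix 1 1 ?A ?B) G \<and> admits_crossing_gate G"
    using admits_crossing_gate_constant by blast
  moreover have "is_neighborhood ?A" "is_neighborhood ?B" "?A \<noteq> ?B"
    by (simp_all add: is_neighborhood_def)
  ultimately show "\<exists>A B :: neighborhood. is_neighborhood A \<and> is_neighborhood B \<and> A \<noteq> B \<and>
      (\<exists>G. uniform_grid (mix 1 1 A B) G \<and> admits_crossing_gate G) \<and>
      (\<forall>G. nonuniform_grid A B G \<longrightarrow> \<not> admits_crossing_gate G)"
    using no_crossing_gate_nonuniform by blast
qed

end
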